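(* Let $n\ge 1$ and $1\le \ell\le n$ be integers. Then there is a homotopy equivalence $$|\ell\text{-}SAT\text{-}n|\simeq \Theta(\operatorname{Cube}(n,n-\ell)).$$
   Context: A hypergraph $\mathcal H=(V,H)$ is a nonempty set $V$ of vertices with a collection $H$ of subsets of $V$, called hyperedges. $\Theta(\mathcal H)$ is the simplicial complex whose simplices are the (nonempty) finite subsets of complements $V\setminus h$ of hyperedges $h\in H$. Simplicial complexes are not distinguished from their geometric realizations. $\operatorname{Cube}(n,k)$ is the hypergraph whose vertices are the vertices of the $n$-cube and whose hyperedges are the sets of vertices spanning $k$-dimensional faces of the $n$-cube. A literal is a variable $x_i$ or its negation $\overline{x_i}$. A Boolean formula in the variables $x_1,\dots,x_n$ is in $\ell$-conjunctive normal form if it is a conjunction of (at least one) clauses, where each clause is a disjunction of exactly $\ell$ literals, no clauses are duplicated, and the same variable does not appear twice in any clause. $\ell\text{-}SAT\text{-}n$ is the set of satisfiable formulas in $\ell$-conjunctive normal form in the variables $x_1,\dots,x_n$ (satisfiable: some truth assignment to $x_1,\dots,x_n$ makes the formula true). $|\ell\text{-}SAT\text{-}n|$ is the simplicial complex with vertex set $\ell\text{-}SAT\text{-}n$ and with a $k$-simplex $[\phi_0,\ldots,\phi_k]$ whenever there is a chain of logical implications $\phi_0\Rightarrow\phi_1\Rightarrow\cdots\Rightarrow\phi_k$ (the $\phi_i$ being distinct as formulas; distinct formulas may be logically equivalent). *)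

theory Defs
  imports "HOL-Analysis.Analysis"
begin

section \<open>Abstract simplicial complexes and their geometric realizations\<close>

definition abstract_complex :: "'a set set \<Rightarrow> bool" where
  "abstract_complex K \<longleftrightarrow>
     (\<forall>\<sigma>\<in>K. finite \<sigma> \<and> \<sigma> \<noteq> {}) \<and>
     (\<forall>\<sigma>\<in>K. \<forall>\<tau>. \<tau> \<subseteq> \<sigma> \<and> \<tau> \<noteq> {} \<longrightarrow> \<tau> \<in> K)"

text \<open>Points of a simplex are given by their barycentric coordinates.\<close>

definition closed_simplex :: "'a set \<Rightarrow> ('a \<Rightarrow> real) set" where
  "closed_simplex \<sigma> = {x. (\<forall>v. 0 \<le> x v) \<and> (\<forall>v. v \<notin> \<sigma> \<longrightarrow> x v = 0) \<and> sum x \<sigma> = 1}"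

text \<open>The topology is the weak (coherent) one: a set is open iff its trace on every closed simplex
  is open. A closed simplex carries the subspace topology from the product topology on
  \<^typ>\<open>'a \<Rightarrow> real\<close>, which on a finite-dimensional simplex is the Euclidean topology.\<close>

definition geometric_realization :: "'a set set \<Rightarrow> ('a \<Rightarrow> real) topology" where
  "geometric_realization K = topology (\<lambda>U.
     U \<subseteq> (\<Union>\<sigma>\<in>K. closed_simplex \<sigma>) \<and>
     (\<forall>\<sigma>\<in>K. openin (top_of_set (closed_simplex \<sigma>)) (U \<inter> closed_simplex \<sigma>)))"

lemma openin_geometric_realization:
  "openin (geometric_realization K) U \<longleftrightarrow>
     U \<subseteq> (\<Union>\<sigma>\<in>K. closed_simplex \<sigma>) \<and>
     (\<forall>\<sigma>\<in>K. openin (top_of_set (closed_simplex \<sigma>)) (U \<inter> closed_simplex \<sigma>))"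
proof -
  have "istopology (\<lambda>U. U \<subseteq> (\<Union>\<sigma>\<in>K. closed_simplex \<sigma>) \<and>
     (\<forall>\<sigma>\<in>K. openin (top_of_set (closed_simplex \<sigma>)) (U \<inter> closed_simplex \<sigma>)))"
    (is "istopology ?P")
    unfolding istopology_def
  proof (intro conjI allI impI)
    fix S T assume S: "?P S" and T: "?P T"
    show "S \<inter> T \<subseteq> (\<Union>\<sigma>\<in>K. closed_simplex \<sigma>)"
      using S by blast
    show "\<forall>\<sigma>\<in>K. openin (top_of_set (closed_simplex \<sigma>)) (S \<inter> T \<inter> closed_simplex \<sigma>)"
    proof
      fix \<sigma> assume "\<sigma> \<in> K"
      then have "openin (top_of_set (closed_simplex \<sigma>))
          ((S \<inter> closed_simplex \<sigma>) \<inter> (T \<inter> closed_simplex \<sigma>))"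
        using S T openin_Int[of "top_of_set (closed_simplex \<sigma>)" "S \<inter> closed_simplex \<sigma>" "T \<inter> closed_simplex \<sigma>"]
        by simp
      then show "openin (top_of_set (closed_simplex \<sigma>)) (S \<inter> T \<inter> closed_simplex \<sigma>)"
        by (simp add: Int_ac)
    qed
  next
    fix \<U> assume U: "\<forall>S\<in>\<U>. ?P S"
    show "\<Union>\<U> \<subseteq> (\<Union>\<sigma>\<in>K. closed_simplex \<sigma>)"
      using U by blast
    show "\<forall>\<sigma>\<in>K. openin (top_of_set (closed_simplex \<sigma>)) (\<Union>\<U> \<inter> closed_simplex \<sigma>)"
    proof
      fix \<sigma> assume "\<sigma> \<in> K"
      then have "openin (top_of_set (closed_simplex \<sigma>)) (\<Union>S\<in>\<U>. S \<inter> closed_simplex \<sigma>)"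
        using U by (intro openin_Union) auto
      moreover have "(\<Union>S\<in>\<U>. S \<inter> closed_simplex \<sigma>) = \<Union>\<U> \<inter> closed_simplex \<sigma>"
        by blast
      ultimately show "openin (top_of_set (closed_simplex \<sigma>)) (\<Union>\<U> \<inter> closed_simplex \<sigma>)"
        by simp
    qed
  qed
  then show ?thesis
    by (simp add: geometric_realization_def topology_inverse')
qed

lemma topspace_geometric_realization:
  "topspace (geometric_realization K) = (\<Union>\<sigma>\<in>K. closed_simplex \<sigma>)"
proof
  show "topspace (geometric_realization K) \<subseteq> (\<Union>\<sigma>\<in>K. closed_simplex \<sigma>)"
    using openin_topspace[of "geometric_realization K"]
    unfolding openin_geometric_realization by blast
  have "(\<Union>\<sigma>\<in>K. closed_simplex \<sigma>) \<inter> closed_simplex \<sigma> = closed_simplex \<sigma>" if "\<sigma> \<in> K" for \<sigma>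
    using that by blast
  then have "openin (geometric_realization K) (\<Union>\<sigma>\<in>K. closed_simplex \<sigma>)"
    by (simp add: openin_geometric_realization)
  then show "(\<Union>\<sigma>\<in>K. closed_simplex \<sigma>) \<subseteq> topspace (geometric_realization K)"
    by (rule openin_subset)
qed

section \<open>Hypergraphs\<close>

type_synonym 'a hypergraph = "'a set \<times> 'a set set"

definition hypergraph :: "'a hypergraph \<Rightarrow> bool" where
  "hypergraph \<H> \<longleftrightarrow> fst \<H> \<noteq> {} \<and> snd \<H> \<subseteq> Pow (fst \<H>)"

definition Theta :: "'a hypergraph \<Rightarrow> 'a set set" where
  "Theta \<H> = {\<sigma>. \<sigma> \<noteq> {} \<and> finite \<sigma> \<and> (\<exists>h\<in>snd \<H>. \<sigma> \<subseteq> fst \<H> - h)}"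

lemma abstract_complex_Theta: "abstract_complex (Theta \<H>)"
  unfolding abstract_complex_def Theta_def using finite_subset by blast

section \<open>The hypergraph of faces of the cube\<close>

text \<open>The dimension of the cube is the cardinality of the index type \<^typ>\<open>'n\<close>.\<close>

definition n_cube :: "(real ^ 'n) set" where
  "n_cube = cbox 0 1"

definition cube_vertices :: "(real ^ 'n) set" where
  "cube_vertices = {v. v extreme_point_of n_cube}"

definition Cube :: "nat \<Rightarrow> (real ^ 'n) hypergraph" where
  "Cube k = (cube_vertices,
     {h. h \<subseteq> cube_vertices \<and> (convex hull h) face_of n_cube \<and> aff_dim (convex hull h) = int k})"

text \<open>Equivalently, the hyperedges are the full vertex sets of the faces of dimension \<^term>\<open>k\<close>.\<close>

lemma Cube_hyperedges:
  "snd (Cube k :: (real ^ 'n) hypergraph) =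
     {cube_vertices \<inter> F |F. F face_of n_cube \<and> aff_dim F = int k}"
proof (intro equalityI subsetI)
  fix h :: "(real ^ 'n) set"
  assume "h \<in> snd (Cube k)"
  then have h: "h \<subseteq> cube_vertices" "(convex hull h) face_of n_cube" "aff_dim (convex hull h) = int k"
    by (auto simp: Cube_def)
  have "x \<in> h" if "x \<in> cube_vertices" "x \<in> convex hull h" for x
    using that extreme_point_of_face[OF h(2), of x] extreme_point_of_convex_hull[of x h]
    by (auto simp: cube_vertices_def)
  with h(1) have "h = cube_vertices \<inter> (convex hull h)"
    using hull_subset[of h convex] by blast
  with h show "h \<in> {cube_vertices \<inter> F |F. F face_of n_cube \<and> aff_dim F = int k}"
    by blast
next
  fix h :: "(real ^ 'n) set"
  assume "h \<in> {cube_vertices \<inter> F |F. F face_of n_cube \<and> aff_dim F = int k}"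
  then obtain F where F: "F face_of n_cube" "aff_dim F = int k" "h = cube_vertices \<inter> F"
    by blast
  have "compact F" "convex F"
    using face_of_imp_compact[of n_cube F] face_of_imp_convex[OF F(1)] F(1)
    by (auto simp: n_cube_def)
  then have "F = convex hull {x. x extreme_point_of F}"
    by (rule Krein_Milman_Minkowski)
  also have "{x. x extreme_point_of F} = h"
    using extreme_point_of_face[OF F(1)] by (auto simp: F(3) cube_vertices_def)
  finally show "h \<in> snd (Cube k)"
    using F by (auto simp: Cube_def)
qed

lemma hypergraph_Cube: "hypergraph (Cube k :: (real ^ 'n) hypergraph)"
proof -
  have "(n_cube :: (real ^ 'n) set) \<noteq> {}"
    by (auto simp: n_cube_def interval_ne_empty_cart)
  then have "(cube_vertices :: (real ^ 'n) set) \<noteq> {}"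
    using Krein_Milman_Minkowski[of "n_cube :: (real ^ 'n) set"]
    by (auto simp: cube_vertices_def n_cube_def)
  then show ?thesis
    by (auto simp: hypergraph_def Cube_def)
qed

section \<open>Satisfiable formulas in conjunctive normal form\<close>

datatype 'v literal = Pos (var: 'v) | Neg (var: 'v)

text \<open>A clause is the disjunction of its set of literals and a formula is the conjunction of its set
  of clauses, so duplicates are excluded and the order is immaterial.\<close>

type_synonym 'v clause = "'v literal set"
type_synonym 'v cnf = "'v clause set"

fun literal_true :: "('v \<Rightarrow> bool) \<Rightarrow> 'v literal \<Rightarrow> bool" where
  "literal_true a (Pos x) \<longleftrightarrow> a x"
| "literal_true a (Neg x) \<longleftrightarrow> \<not> a x"

definition models :: "('v \<Rightarrow> bool) \<Rightarrow> 'v cnf \<Rightarrow> bool" where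
  "models a \<phi> \<longleftrightarrow> (\<forall>C\<in>\<phi>. \<exists>L\<in>C. literal_true a L)"

definition is_clause :: "nat \<Rightarrow> 'v clause \<Rightarrow> bool" where
  "is_clause l C \<longleftrightarrow> finite C \<and> card C = l \<and> inj_on var C"

definition is_cnf :: "nat \<Rightarrow> 'v cnf \<Rightarrow> bool" where
  "is_cnf l \<phi> \<longleftrightarrow> finite \<phi> \<and> \<phi> \<noteq> {} \<and> (\<forall>C\<in>\<phi>. is_clause l C)"

definition SAT :: "nat \<Rightarrow> 'v cnf set" where
  "SAT l = {\<phi>. is_cnf l \<phi> \<and> (\<exists>a. models a \<phi>)}"

definition logically_implies :: "'v cnf \<Rightarrow> 'v cnf \<Rightarrow> bool" where
  "logically_implies \<phi> \<psi> \<longleftrightarrow> (\<forall>a. models a \<phi> \<longrightarrow> models a \<psi>)"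

text \<open>Implication is only a preorder: distinct but equivalent formulas are distinct vertices and
  span an edge.\<close>

definition SAT_complex :: "nat \<Rightarrow> 'v cnf set set" where
  "SAT_complex l =
     {set \<phi>s |\<phi>s. \<phi>s \<noteq> [] \<and> distinct \<phi>s \<and> set \<phi>s \<subseteq> SAT l \<and> successively logically_implies \<phi>s}"

lemma abstract_complex_SAT_complex: "abstract_complex (SAT_complex l)"
proof -
  have trans: "transp logically_implies"
    by (auto simp: transp_def logically_implies_def)
  have "\<tau> \<in> SAT_complex l" if "\<sigma> \<in> SAT_complex l" "\<tau> \<subseteq> \<sigma>" "\<tau> \<noteq> {}" for \<sigma> \<tau> :: "'a cnf set"
  proof -
    obtain \<phi>s where s: "\<sigma> = set \<phi>s" "distinct \<phi>s" "set \<phi>s \<subseteq> SAT l" "sorted_wrt logically_implies \<phi>s"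
      using \<open>\<sigma> \<in> SAT_complex l\<close>
      by (auto simp: SAT_complex_def successively_conv_sorted_wrt[OF trans])
    define \<psi>s where "\<psi>s = filter (\<lambda>\<phi>. \<phi> \<in> \<tau>) \<phi>s"
    have "set \<psi>s = \<tau>" "distinct \<psi>s"
      using s \<open>\<tau> \<subseteq> \<sigma>\<close> by (auto simp: \<psi>s_def)
    moreover have "successively logically_implies \<psi>s"
      using s by (simp add: \<psi>s_def successively_conv_sorted_wrt[OF trans] sorted_wrt_filter)
    moreover have "\<psi>s \<noteq> []" "set \<psi>s \<subseteq> SAT l"
      using \<open>set \<psi>s = \<tau>\<close> s \<open>\<tau> \<subseteq> \<sigma>\<close> \<open>\<tau> \<noteq> {}\<close> by auto
    ultimately show ?thesis
      unfolding SAT_complex_def by blast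
  qed
  moreover have "finite \<sigma> \<and> \<sigma> \<noteq> {}" if "\<sigma> \<in> SAT_complex l" for \<sigma> :: "'a cnf set"
    using that by (auto simp: SAT_complex_def)
  ultimately show ?thesis
    unfolding abstract_complex_def by blast
qed

end

theory Submission
  imports Defs
begin

text \<open>Write $K$ for the complex on the right. A clause with $\ell$ literals is false exactly at the vertices
  of an $(n - \ell)$-dimensional face of the cube, and every such face arises in this way. So a
  nonempty set $\sigma$ of cube vertices, read as truth assignments, is a simplex of $K$ iff all of
  $\sigma$ satisfies some common clause of length $\ell$ (\<open>Theta_Cube_eq\<close>).

  Sending a satisfiable formula $\phi$ to the set $f(\phi)$ of vertices that satisfy it gives a map
  into the faces of $K$, and $\phi$ implies $\psi$ iff $f(\phi) \subseteq f(\psi)$. In the other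
  direction let $g(\sigma)$ be the conjunction of all clauses of length $\ell$ that hold on all of
  $\sigma$. This is the strongest formula that holds on $\sigma$, which is the Galois connection
  $f(g(\sigma)) \subseteq f(\phi) \longleftrightarrow \sigma \subseteq f(\phi)$
  (\<open>face_galois_SAT\<close>). A Galois connection between preorders makes their order complexes
  homotopy equivalent, and the order complex of the faces of $K$ is the barycentric subdivision
  of $K$.

  Both steps are done at once for an arbitrary finite complex $K$ and an arbitrary Galois connection
  (\<open>homotopy_equivalent_chain_complex\<close>), by explicit maps between the realizations. One way, extend
  $p \mapsto$ barycentre of $f(p)$ affinely. The other way, send a point $y$ of $K$ to a convex
  combination of the vertices $g(\tau)$, where $\tau$ runs through the superlevel sets
  $\{v.\; y_v > t\}$ of the barycentric coordinates of $y$; these form a chain, as in the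
  barycentric subdivision. Each composite moves a point only within a closed simplex that contains
  it, so it is joined to the identity by a straight-line homotopy. For the composite on $K$ that
  simplex is $f(g(\sigma))$, with $\sigma$ the support of the point; for the composite on the order
  complex it is the union of the given chain and the chain of the $g(\tau)$, which is again a chain
  because every superlevel set of an affine combination of barycentres of a chain is comparable
  with all its members (\<open>level_set_comparable\<close>).\<close>

section \<open>Finite complexes\<close>

abbreviation points :: "'a set set \<Rightarrow> ('a \<Rightarrow> real) set" where
  "points K \<equiv> (\<Union>\<sigma>\<in>K. closed_simplex \<sigma>)"

lemma closed_closed_simplex:
  assumes "finite \<sigma>"
  shows "closed (closed_simplex \<sigma>)"
proof -
  have "continuous_on UNIV (\<lambda>x::'a \<Rightarrow> real. x v)" for v
    by simp
  then have c: "closed {x::'a \<Rightarrow> real. 0 \<le> x v}" "closed {x::'a \<Rightarrow> real. x v = 0}" for v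
    by (auto intro!: closed_Collect_le closed_Collect_eq continuous_on_const)
  have "closed {x::'a \<Rightarrow> real. sum x \<sigma> = 1}"
    by (intro closed_Collect_eq continuous_on_const continuous_on_sum) simp
  with c have "closed ({x::'a \<Rightarrow> real. \<forall>v. 0 \<le> x v} \<inter> {x. \<forall>v. v \<notin> \<sigma> \<longrightarrow> x v = 0} \<inter> {x. sum x \<sigma> = 1})"
    by (intro closed_Int closed_Collect_all closed_Collect_imp) auto
  then show ?thesis
    by (simp add: closed_simplex_def Int_def conj_assoc)
qed

text \<open>Finitely many closed simplices cover the realization, and each is closed in the product topology, so
  a set with relatively closed traces is closed. This turns continuity into a coordinatewise matter.\<close>

lemma geometric_realization_finite:
  assumes "finite K" and "\<And>\<sigma>. \<sigma> \<in> K \<Longrightarrow> finite \<sigma>"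
  shows "geometric_realization K = top_of_set (points K)"
  unfolding topology_eq
proof (intro allI iffI)
  fix U :: "('a \<Rightarrow> real) set"
  assume "openin (geometric_realization K) U"
  then have U: "U \<subseteq> points K"
    and tr: "\<And>\<sigma>. \<sigma> \<in> K \<Longrightarrow> openin (top_of_set (closed_simplex \<sigma>)) (U \<inter> closed_simplex \<sigma>)"
    by (auto simp: openin_geometric_realization)
  have "closed (closed_simplex \<sigma> - U)" if "\<sigma> \<in> K" for \<sigma>
  proof -
    have "closedin (top_of_set (closed_simplex \<sigma>)) (closed_simplex \<sigma> - U \<inter> closed_simplex \<sigma>)"
      using tr[OF that] by (metis closedin_diff closedin_topspace topspace_euclidean_subtopology)
    moreover have "closed_simplex \<sigma> - U \<inter> closed_simplex \<sigma> = closed_simplex \<sigma> - U"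
      by blast
    ultimately show ?thesis
      using closed_closed_simplex[OF assms(2)[OF that]] closedin_closed_trans by metis
  qed
  then have "closed (\<Union>\<sigma>\<in>K. closed_simplex \<sigma> - U)"
    using assms(1) by (intro closed_UN) auto
  then have "openin (top_of_set (points K)) (points K \<inter> - (\<Union>\<sigma>\<in>K. closed_simplex \<sigma> - U))"
    by (intro openin_open_Int open_Compl)
  moreover have "points K \<inter> - (\<Union>\<sigma>\<in>K. closed_simplex \<sigma> - U) = U"
    using U by blast
  ultimately show "openin (top_of_set (points K)) U"
    by simp
next
  fix U :: "('a \<Rightarrow> real) set"
  assume "openin (top_of_set (points K)) U"
  then obtain T where T: "open T" "U = points K \<inter> T"
    by (auto simp: openin_open)
  have "U \<inter> closed_simplex \<sigma> = closed_simplex \<sigma> \<inter> T" if "\<sigma> \<in> K" for \<sigma>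
    using that T by blast
  then show "openin (geometric_realization K) U"
    using T by (auto simp: openin_geometric_realization openin_open)
qed

lemma closed_simplex_mono:
  assumes "x \<in> closed_simplex \<sigma>" "\<sigma> \<subseteq> \<tau>" "finite \<tau>"
  shows "x \<in> closed_simplex \<tau>"
proof -
  have "sum x \<sigma> = sum x \<tau>"
    using assms by (intro sum.mono_neutral_left) (auto simp: closed_simplex_def)
  with assms show ?thesis
    by (auto simp: closed_simplex_def)
qed

lemma closed_simplex_convex_combination:
  assumes "finite I" and "\<And>i. i \<in> I \<Longrightarrow> 0 \<le> a i" and "sum a I = 1"
    and "\<And>i. i \<in> I \<Longrightarrow> a i \<noteq> 0 \<Longrightarrow> z i \<in> closed_simplex \<sigma>"
  shows "(\<lambda>v. \<Sum>i\<in>I. a i * z i v) \<in> closed_simplex \<sigma>"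
proof -
  have nn: "0 \<le> a i * z i v" if "i \<in> I" for i v
    using assms(2)[OF that] assms(4)[OF that] by (cases "a i = 0") (auto simp: closed_simplex_def)
  have out: "a i * z i v = 0" if "i \<in> I" "v \<notin> \<sigma>" for i v
    using assms(4)[OF that(1)] that(2) by (cases "a i = 0") (auto simp: closed_simplex_def)
  have "(\<Sum>v\<in>\<sigma>. \<Sum>i\<in>I. a i * z i v) = (\<Sum>i\<in>I. a i * sum (z i) \<sigma>)"
    by (subst sum.swap) (simp add: sum_distrib_left)
  also have "\<dots> = sum a I"
    using assms(4) by (intro sum.cong) (auto simp: closed_simplex_def)
  finally show ?thesis
    using nn out assms(3) by (auto simp: closed_simplex_def intro!: sum_nonneg sum.neutral)
qed

definition barycenter :: "'a set \<Rightarrow> 'a \<Rightarrow> real" where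
  "barycenter \<sigma> v = (if v \<in> \<sigma> then 1 / card \<sigma> else 0)"

lemma barycenter_in_closed_simplex:
  assumes "finite \<sigma>" "\<sigma> \<noteq> {}"
  shows "barycenter \<sigma> \<in> closed_simplex \<sigma>"
  using assms by (auto simp: closed_simplex_def barycenter_def)

text \<open>Two maps that send each point into a common closed simplex are joined by the straight-line
  homotopy, which never leaves that simplex. Both homotopies below are of this kind.\<close>

lemma homotopic_with_straight_line:
  fixes h k :: "('c \<Rightarrow> real) \<Rightarrow> 'a \<Rightarrow> real"
  assumes h: "continuous_on X h" and k: "continuous_on X k"
    and common: "\<And>x. x \<in> X \<Longrightarrow> \<exists>\<sigma>\<in>K. h x \<in> closed_simplex \<sigma> \<and> k x \<in> closed_simplex \<sigma>"
  shows "homotopic_with (\<lambda>_. True) (top_of_set X) (top_of_set (points K)) h k"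
proof -
  define H where "H = (\<lambda>(t::real, x) v. (1 - t) * h x v + t * k x v)"
  have hv: "continuous_on ({0..1::real} \<times> X) (\<lambda>p. h (snd p) v)" for v
    by (rule continuous_on_compose2[OF continuous_on_product_then_coordinatewise[OF h] continuous_on_snd]) auto
  have kv: "continuous_on ({0..1::real} \<times> X) (\<lambda>p. k (snd p) v)" for v
    by (rule continuous_on_compose2[OF continuous_on_product_then_coordinatewise[OF k] continuous_on_snd]) auto
  have "continuous_on ({0..1} \<times> X) H"
    unfolding H_def case_prod_beta
    by (intro continuous_on_coordinatewise_then_product continuous_intros hv kv)
  moreover have "H p \<in> points K" if p: "p \<in> {0..1} \<times> X" for p
  proof -
    obtain t x where tx: "p = (t, x)" "0 \<le> t" "t \<le> 1" "x \<in> X"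
      using p by auto
    obtain \<sigma> where \<sigma>: "\<sigma> \<in> K" "h x \<in> closed_simplex \<sigma>" "k x \<in> closed_simplex \<sigma>"
      using common tx(4) by blast
    have "(\<lambda>v. \<Sum>b\<in>UNIV. (if b then t else 1 - t) * (if b then k x else h x) v) \<in> closed_simplex \<sigma>"
      using tx \<sigma> by (intro closed_simplex_convex_combination) (auto simp: UNIV_bool)
    then have "H p \<in> closed_simplex \<sigma>"
      by (simp add: H_def tx(1) UNIV_bool add.commute)
    with \<sigma>(1) show ?thesis
      by blast
  qed
  ultimately have "continuous_map (prod_topology (top_of_set {0..1}) (top_of_set X)) (top_of_set (points K)) H"
    by (auto simp flip: subtopology_Times simp: continuous_map_in_subtopology)
  then show ?thesis
    unfolding homotopic_with_def by (intro exI[of _ H]) (auto simp: H_def)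
qed

section \<open>Galois connections with face posets\<close>

text \<open>The order complex of the preorder on \<open>P\<close> that \<open>f\<close> pulls back from inclusion: elements with the
  same image are distinct vertices, joined by an edge.\<close>

definition chain_complex :: "'b set \<Rightarrow> ('b \<Rightarrow> 'a set) \<Rightarrow> 'b set set" where
  "chain_complex P f = {S. S \<subseteq> P \<and> finite S \<and> S \<noteq> {} \<and> (\<forall>p\<in>S. \<forall>q\<in>S. f p \<subseteq> f q \<or> f q \<subseteq> f p)}"

text \<open>The law \<open>galois\<close> says that among the sets \<open>f p\<close> that contain a face \<open>\<sigma>\<close> there is a least one,
  attained at \<open>g \<sigma>\<close>. Monotonicity of \<open>f \<circ> g\<close> and the inclusion \<open>\<sigma> \<subseteq> f (g \<sigma>)\<close> follow from it.\<close>

locale face_galois =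
  fixes K :: "'a set set" and P :: "'b set" and f :: "'b \<Rightarrow> 'a set" and g :: "'a set \<Rightarrow> 'b"
  assumes complex: "abstract_complex K"
    and finite_vertices: "finite (\<Union>K)"
    and finite_P: "finite P"
    and f_in: "p \<in> P \<Longrightarrow> f p \<in> K"
    and g_in: "\<sigma> \<in> K \<Longrightarrow> g \<sigma> \<in> P"
    and galois: "\<sigma> \<in> K \<Longrightarrow> p \<in> P \<Longrightarrow> f (g \<sigma>) \<subseteq> f p \<longleftrightarrow> \<sigma> \<subseteq> f p"
begin

lemma finite_K: "finite K"
  using finite_vertices by (rule finite_UnionD)

lemma face_finite: "\<sigma> \<in> K \<Longrightarrow> finite \<sigma>" and face_nonempty: "\<sigma> \<in> K \<Longrightarrow> \<sigma> \<noteq> {}"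
  using complex by (auto simp: abstract_complex_def)

lemma face_subset: "\<sigma> \<in> K \<Longrightarrow> \<tau> \<subseteq> \<sigma> \<Longrightarrow> \<tau> \<noteq> {} \<Longrightarrow> \<tau> \<in> K"
  using complex unfolding abstract_complex_def by blast

lemma closure_increasing: "\<sigma> \<in> K \<Longrightarrow> \<sigma> \<subseteq> f (g \<sigma>)"
  using galois g_in by blast

lemma closure_mono: "\<sigma> \<in> K \<Longrightarrow> \<tau> \<in> K \<Longrightarrow> \<sigma> \<subseteq> \<tau> \<Longrightarrow> f (g \<sigma>) \<subseteq> f (g \<tau>)"
  using galois g_in closure_increasing by blast

definition to_faces :: "('b \<Rightarrow> real) \<Rightarrow> 'a \<Rightarrow> real" where
  "to_faces x v = (\<Sum>p\<in>P. x p * barycenter (f p) v)"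

text \<open>On a point \<open>y\<close> of the realization, the weight of a face \<open>\<tau>\<close> is positive iff \<open>\<tau>\<close> is a superlevel set of
  \<open>y\<close>, that is, iff \<open>y\<close> is positive on \<open>\<tau>\<close> and smaller at every vertex outside \<open>\<tau>\<close> than at every vertex
  in \<open>\<tau>\<close>. The homotopies use only which weights vanish, so this product, whose continuity is
  immediate, can stand in for the barycentric coordinates of the subdivision.\<close>

definition level_weight :: "('a \<Rightarrow> real) \<Rightarrow> 'a set \<Rightarrow> real" where
  "level_weight y \<tau> = (\<Prod>v\<in>\<tau>. y v * (\<Prod>u\<in>\<Union>K - \<tau>. max 0 (y v - y u)))"

definition from_faces :: "('a \<Rightarrow> real) \<Rightarrow> 'b \<Rightarrow> real" where
  "from_faces y p = (\<Sum>\<tau>\<in>K. level_weight y \<tau> / (\<Sum>\<tau>\<in>K. level_weight y \<tau>) * barycenter {g \<tau>} p)"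

lemma to_faces_in_closed_simplex:
  assumes "x \<in> closed_simplex S" "S \<subseteq> P" "finite \<tau>" "\<And>p. p \<in> S \<Longrightarrow> f p \<subseteq> \<tau>"
  shows "to_faces x \<in> closed_simplex \<tau>"
  unfolding to_faces_def
proof (rule closed_simplex_convex_combination[OF finite_P])
  show "sum x P = 1"
    using closed_simplex_mono[OF assms(1,2) finite_P] by (simp add: closed_simplex_def)
  show "0 \<le> x p" for p
    using assms(1) by (simp add: closed_simplex_def)
  fix p assume "p \<in> P" "x p \<noteq> 0"
  then have "f p \<in> K" "p \<in> S"
    using assms(1) f_in by (auto simp: closed_simplex_def)
  then show "barycenter (f p) \<in> closed_simplex \<tau>"
    using assms(3,4) face_finite face_nonempty
    by (blast intro: closed_simplex_mono barycenter_in_closed_simplex)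
qed

text \<open>The sets \<open>f p\<close> for \<open>p\<close> in a chain have a largest member, and it contains all their barycentres.\<close>

lemma to_faces_in_points:
  assumes "x \<in> closed_simplex S" "S \<in> chain_complex P f"
  shows "to_faces x \<in> points K"
proof -
  have S: "finite S" "S \<noteq> {}" "S \<subseteq> P" and ch: "\<And>p q. p \<in> S \<Longrightarrow> q \<in> S \<Longrightarrow> f p \<subseteq> f q \<or> f q \<subseteq> f p"
    using assms(2) by (auto simp: chain_complex_def)
  have "finite (f ` S)" "f ` S \<noteq> {}"
    using S by auto
  then obtain m where m: "m \<in> f ` S" "\<And>b. b \<in> f ` S \<Longrightarrow> m \<le> b \<Longrightarrow> m = b"
    using finite_has_maximal by meson
  then have "f p \<subseteq> m" if "p \<in> S" for p
    using that ch by blast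
  moreover have "m \<in> K"
    using m(1) S(3) f_in by blast
  ultimately show ?thesis
    using to_faces_in_closed_simplex[OF assms(1) S(3)] face_finite by blast
qed

lemma level_weight_nonneg: "(\<And>v. 0 \<le> y v) \<Longrightarrow> 0 \<le> level_weight y \<tau>"
  unfolding level_weight_def by (auto intro!: prod_nonneg mult_nonneg_nonneg)

lemma level_weight_nonzero:
  assumes "level_weight y \<tau> \<noteq> 0" "\<tau> \<in> K" "v \<in> \<tau>"
  shows "y v \<noteq> 0" and "u \<in> \<Union>K \<Longrightarrow> u \<notin> \<tau> \<Longrightarrow> y u < y v"
proof -
  have nz: "y v * (\<Prod>u\<in>\<Union>K - \<tau>. max 0 (y v - y u)) \<noteq> 0"
    using assms(1,3) face_finite[OF assms(2)] unfolding level_weight_def by auto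
  then show "y v \<noteq> 0"
    by simp
  show "y u < y v" if "u \<in> \<Union>K" "u \<notin> \<tau>"
  proof -
    have "max 0 (y v - y u) \<noteq> 0"
      using nz that finite_vertices by (auto simp: prod_zero_iff)
    then show ?thesis
      by linarith
  qed
qed

lemma level_sets_chain:
  assumes "level_weight y \<tau> \<noteq> 0" "\<tau> \<in> K" "level_weight y \<tau>' \<noteq> 0" "\<tau>' \<in> K"
  shows "\<tau> \<subseteq> \<tau>' \<or> \<tau>' \<subseteq> \<tau>"
proof (rule ccontr)
  assume "\<not> ?thesis"
  then obtain u v where "u \<in> \<tau>" "u \<notin> \<tau>'" "v \<in> \<tau>'" "v \<notin> \<tau>"
    by blast
  then show False
    using level_weight_nonzero(2)[of y \<tau> u v] level_weight_nonzero(2)[of y \<tau>' v u] assms by force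
qed

lemma support_face:
  assumes "y \<in> points K"
  shows "{v. y v \<noteq> 0} \<in> K" and "y \<in> closed_simplex {v. y v \<noteq> 0}"
proof -
  obtain \<sigma>' where \<sigma>': "\<sigma>' \<in> K" "y \<in> closed_simplex \<sigma>'"
    using assms by blast
  let ?\<sigma> = "{v. y v \<noteq> 0}"
  have sub: "?\<sigma> \<subseteq> \<sigma>'"
    using \<sigma>'(2) by (auto simp: closed_simplex_def)
  have "sum y ?\<sigma> = sum y \<sigma>'"
    using sub face_finite[OF \<sigma>'(1)] by (intro sum.mono_neutral_left) auto
  then have s: "sum y ?\<sigma> = 1"
    using \<sigma>'(2) by (simp add: closed_simplex_def)
  then have "?\<sigma> \<noteq> {}"
    by (metis sum.empty zero_neq_one)
  then show "?\<sigma> \<in> K"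
    using face_subset[OF \<sigma>'(1) sub] by blast
  show "y \<in> closed_simplex ?\<sigma>"
    using s \<sigma>'(2) by (simp add: closed_simplex_def)
qed

text \<open>The set where \<open>y\<close> attains its maximum is a superlevel set, so \<open>from_faces\<close> never divides by zero.\<close>

lemma sum_level_weight_pos:
  assumes "y \<in> points K"
  shows "0 < (\<Sum>\<tau>\<in>K. level_weight y \<tau>)"
proof -
  define \<sigma> where "\<sigma> = {v. y v \<noteq> 0}"
  have \<sigma>: "\<sigma> \<in> K" "y \<in> closed_simplex \<sigma>" "\<And>v. v \<in> \<sigma> \<longleftrightarrow> y v \<noteq> 0"
    using support_face[OF assms] by (simp_all add: \<sigma>_def)
  have nn: "0 \<le> y v" for v
    using \<sigma>(2) by (simp add: closed_simplex_def)
  have fin: "finite \<sigma>" "\<sigma> \<noteq> {}"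
    using \<sigma>(1) face_finite face_nonempty by auto
  define m where "m = Max (y ` \<sigma>)"
  define \<tau> where "\<tau> = {v \<in> \<sigma>. y v = m}"
  have "m \<in> y ` \<sigma>"
    unfolding m_def using fin by (intro Max_in) auto
  then have "\<tau> \<noteq> {}"
    by (auto simp: \<tau>_def)
  then have "\<tau> \<in> K"
    using face_subset[OF \<sigma>(1), of \<tau>] by (auto simp: \<tau>_def)
  have "0 < m"
    using \<open>m \<in> y ` \<sigma>\<close> \<sigma>(3) nn by (metis imageE less_eq_real_def)
  have "y u < m" if "u \<notin> \<tau>" for u
  proof (cases "u \<in> \<sigma>")
    case True
    then have "y u \<le> m"
      unfolding m_def using fin by (intro Max_ge) auto
    with that True show ?thesis
      by (auto simp: \<tau>_def)
  next
    case False
    then show ?thesis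
      using \<sigma>(3) \<open>0 < m\<close> by auto
  qed
  then have "0 < level_weight y \<tau>"
    unfolding level_weight_def using \<open>0 < m\<close>
    by (intro prod_pos ballI mult_pos_pos) (auto simp: \<tau>_def)
  then show ?thesis
    using \<open>\<tau> \<in> K\<close> finite_K nn level_weight_nonneg by (intro sum_pos2) auto
qed

lemma from_faces_in_closed_simplex:
  assumes "y \<in> points K" "finite S" "\<And>\<tau>. \<tau> \<in> K \<Longrightarrow> level_weight y \<tau> \<noteq> 0 \<Longrightarrow> g \<tau> \<in> S"
  shows "from_faces y \<in> closed_simplex S"
  unfolding from_faces_def
proof (rule closed_simplex_convex_combination[OF finite_K])
  have nn: "0 \<le> y v" for v
    using assms(1) by (auto simp: closed_simplex_def)
  have pos: "0 < (\<Sum>\<tau>\<in>K. level_weight y \<tau>)"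
    using sum_level_weight_pos assms(1) .
  show "(\<Sum>\<tau>\<in>K. level_weight y \<tau> / (\<Sum>\<tau>\<in>K. level_weight y \<tau>)) = 1"
    using pos by (simp flip: sum_divide_distrib)
  show "0 \<le> level_weight y \<tau> / (\<Sum>\<tau>\<in>K. level_weight y \<tau>)" for \<tau>
    using pos level_weight_nonneg[OF nn] by simp
  show "barycenter {g \<tau>} \<in> closed_simplex S"
    if "\<tau> \<in> K" "level_weight y \<tau> / (\<Sum>\<tau>\<in>K. level_weight y \<tau>) \<noteq> 0" for \<tau>
    using that assms(2,3)
    by (intro closed_simplex_mono[OF barycenter_in_closed_simplex]) auto
qed

text \<open>The vertices of the simplex of the order complex that carries the image of \<open>y\<close>.\<close>

definition level_generators :: "('a \<Rightarrow> real) \<Rightarrow> 'b set" where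
  "level_generators y = g ` {\<tau> \<in> K. level_weight y \<tau> \<noteq> 0}"

lemma finite_level_generators: "finite (level_generators y)"
  using finite_K by (simp add: level_generators_def)

lemma level_generators_subset: "level_generators y \<subseteq> P"
  using g_in by (auto simp: level_generators_def)

lemma level_generators_nonempty:
  assumes "y \<in> points K"
  shows "level_generators y \<noteq> {}"
proof -
  have "\<exists>\<tau>\<in>K. level_weight y \<tau> \<noteq> 0"
    using sum_level_weight_pos[OF assms] by (metis less_irrefl sum.neutral)
  then show ?thesis
    by (auto simp: level_generators_def)
qed

lemma level_generators_chain:
  assumes "p \<in> level_generators y" "q \<in> level_generators y"
  shows "f p \<subseteq> f q \<or> f q \<subseteq> f p"
proof -
  obtain \<sigma> \<tau> where "\<sigma> \<in> K" "level_weight y \<sigma> \<noteq> 0" "p = g \<sigma>"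
    and "\<tau> \<in> K" "level_weight y \<tau> \<noteq> 0" "q = g \<tau>"
    using assms by (auto simp: level_generators_def)
  then show ?thesis
    using level_sets_chain[of y \<sigma> \<tau>] closure_mono[of \<sigma> \<tau>] closure_mono[of \<tau> \<sigma>] by metis
qed

lemma from_faces_in_closed_simplex_level_generators:
  "y \<in> points K \<Longrightarrow> from_faces y \<in> closed_simplex (level_generators y)"
  by (intro from_faces_in_closed_simplex finite_level_generators) (auto simp: level_generators_def)

lemma level_generators_in_chain_complex:
  "y \<in> points K \<Longrightarrow> level_generators y \<in> chain_complex P f"
  unfolding chain_complex_def
  using level_generators_subset finite_level_generators level_generators_nonempty level_generators_chain
  by blast

text \<open>If \<open>v\<close> lies in the level set but not in \<open>f p\<close>, and \<open>u\<close> in \<open>f p\<close> but not in the level set, then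
  \<open>to_faces x\<close> is larger at \<open>v\<close> than at \<open>u\<close>, so some \<open>f q\<close> in the chain contains \<open>v\<close> and not \<open>u\<close>. Such an
  \<open>f q\<close> is not comparable with \<open>f p\<close>.\<close>

lemma level_set_comparable:
  assumes x: "x \<in> closed_simplex S" and S: "S \<in> chain_complex P f" and p: "p \<in> S"
    and \<tau>: "\<tau> \<in> K" "level_weight (to_faces x) \<tau> \<noteq> 0"
  shows "\<tau> \<subseteq> f p \<or> f p \<subseteq> \<tau>"
proof (rule ccontr)
  assume "\<not> ?thesis"
  then obtain v u where v: "v \<in> \<tau>" "v \<notin> f p" and u: "u \<in> f p" "u \<notin> \<tau>"
    by blast
  have SP: "S \<subseteq> P"
    using S by (simp add: chain_complex_def)
  have "u \<in> \<Union>K"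
    using u(1) p f_in SP by blast
  then have "to_faces x u < to_faces x v"
    using level_weight_nonzero(2)[OF \<tau>(2,1) v(1)] u(2) by blast
  then obtain q where q: "q \<in> P" "x q * barycenter (f q) u < x q * barycenter (f q) v"
    unfolding to_faces_def by (meson sum_mono not_less)
  have "x q \<noteq> 0"
    using q(2) by auto
  then have "q \<in> S" "0 < x q"
    using x by (auto simp: closed_simplex_def less_le)
  have "barycenter (f q) u < barycenter (f q) v"
    using q(2) \<open>0 < x q\<close> by simp
  then have "u \<notin> f q" "v \<in> f q"
    by (auto simp: barycenter_def split: if_splits)
  moreover have "f p \<subseteq> f q \<or> f q \<subseteq> f p"
    using S p \<open>q \<in> S\<close> by (simp add: chain_complex_def)
  ultimately show False
    using u v by blast
qed

lemma continuous_coordinate: "continuous_on X (\<lambda>x::'c \<Rightarrow> real. x v)"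
  by (rule continuous_on_product_then_coordinatewise) simp

lemma continuous_to_faces: "continuous_on X to_faces"
  unfolding to_faces_def
  by (intro continuous_on_coordinatewise_then_product continuous_on_sum continuous_on_mult
      continuous_on_const continuous_coordinate)

lemma continuous_level_weight: "continuous_on X (\<lambda>y. level_weight y \<tau>)"
  unfolding level_weight_def
  by (intro continuous_on_prod continuous_on_mult continuous_on_max continuous_on_diff
      continuous_on_const continuous_coordinate)

lemma continuous_from_faces: "continuous_on (points K) from_faces"
  unfolding from_faces_def using sum_level_weight_pos
  by (intro continuous_on_coordinatewise_then_product continuous_on_sum continuous_on_mult
      continuous_on_divide continuous_level_weight continuous_on_const) force

theorem homotopy_equivalent_chain_complex:
  "geometric_realization (chain_complex P f) homotopy_equivalent_space geometric_realization K"
proof -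
  let ?C = "chain_complex P f"
  have "?C \<subseteq> Pow P"
    by (auto simp: chain_complex_def)
  then have C: "finite ?C" "\<And>S. S \<in> ?C \<Longrightarrow> finite S"
    using finite_P finite_subset by (auto simp: chain_complex_def)
  have to: "to_faces ` points ?C \<subseteq> points K"
    using to_faces_in_points by auto
  have from': "from_faces ` points K \<subseteq> points ?C"
    using from_faces_in_closed_simplex_level_generators level_generators_in_chain_complex by blast
  have "\<exists>S\<in>?C. (from_faces \<circ> to_faces) x \<in> closed_simplex S \<and> id x \<in> closed_simplex S"
    if x: "x \<in> points ?C" for x
  proof -
    obtain S where S: "S \<in> ?C" "x \<in> closed_simplex S"
      using x by blast
    have y: "to_faces x \<in> points K"
      using to x by blast
    let ?G = "level_generators (to_faces x)"
    have fin: "finite (S \<union> ?G)"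
      using S(1) finite_level_generators by (auto simp: chain_complex_def)
    \<comment> \<open>A member of the chain compares with the level set \<open>\<tau>\<close>; the Galois law and \<open>\<tau> \<subseteq> f (g \<tau>)\<close> carry
        the comparison over to \<open>f (g \<tau>)\<close>.\<close>
    have "f p \<subseteq> f q \<or> f q \<subseteq> f p" if pq: "p \<in> S" "q \<in> ?G" for p q
    proof -
      obtain \<tau> where \<tau>: "\<tau> \<in> K" "level_weight (to_faces x) \<tau> \<noteq> 0" "q = g \<tau>"
        using pq(2) by (auto simp: level_generators_def)
      have "p \<in> P"
        using S(1) pq(1) by (auto simp: chain_complex_def)
      then show ?thesis
        using level_set_comparable[OF S(2,1) pq(1) \<tau>(1,2)] galois[OF \<tau>(1)] closure_increasing[OF \<tau>(1)]
          \<tau>(3) by blast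
    qed
    moreover have "\<forall>p\<in>S. \<forall>q\<in>S. f p \<subseteq> f q \<or> f q \<subseteq> f p" "S \<noteq> {}" "S \<subseteq> P"
      using S(1) by (auto simp: chain_complex_def)
    ultimately have "S \<union> ?G \<in> ?C"
      using level_generators_chain[where y = "to_faces x"] fin level_generators_subset
      unfolding chain_complex_def by blast
    moreover have "x \<in> closed_simplex (S \<union> ?G)"
      using closed_simplex_mono[OF S(2) _ fin] by blast
    moreover have "from_faces (to_faces x) \<in> closed_simplex (S \<union> ?G)"
      using closed_simplex_mono[OF from_faces_in_closed_simplex_level_generators[OF y] _ fin] by blast
    ultimately show ?thesis
      by auto
  qed
  then have 1: "homotopic_with (\<lambda>_. True) (top_of_set (points ?C)) (top_of_set (points ?C))
      (from_faces \<circ> to_faces) id"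
    by (intro homotopic_with_straight_line continuous_on_compose continuous_to_faces
        continuous_on_subset[OF continuous_from_faces to] continuous_on_id')
  have "\<exists>\<sigma>\<in>K. (to_faces \<circ> from_faces) y \<in> closed_simplex \<sigma> \<and> id y \<in> closed_simplex \<sigma>"
    if y: "y \<in> points K" for y
  proof -
    define \<sigma> where "\<sigma> = {v. y v \<noteq> 0}"
    have \<sigma>: "\<sigma> \<in> K" "y \<in> closed_simplex \<sigma>" "\<And>v. v \<in> \<sigma> \<longleftrightarrow> y v \<noteq> 0"
      using support_face[OF y] by (simp_all add: \<sigma>_def)
    have T: "f (g \<sigma>) \<in> K"
      using f_in g_in \<sigma>(1) by blast
    have "f p \<subseteq> f (g \<sigma>)" if "p \<in> level_generators y" for p
      using that closure_mono \<sigma>(1,3) level_weight_nonzero(1)[of y]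
      by (auto simp: level_generators_def subset_iff)
    then have "to_faces (from_faces y) \<in> closed_simplex (f (g \<sigma>))"
      by (intro to_faces_in_closed_simplex[OF from_faces_in_closed_simplex_level_generators[OF y]]
          level_generators_subset face_finite[OF T])
    moreover have "y \<in> closed_simplex (f (g \<sigma>))"
      using closed_simplex_mono[OF \<sigma>(2) closure_increasing[OF \<sigma>(1)] face_finite[OF T]] .
    ultimately show ?thesis
      using T by auto
  qed
  then have 2: "homotopic_with (\<lambda>_. True) (top_of_set (points K)) (top_of_set (points K))
      (to_faces \<circ> from_faces) id"
    by (intro homotopic_with_straight_line continuous_on_compose continuous_to_faces
        continuous_from_faces continuous_on_id')
  have "top_of_set (points ?C) homotopy_equivalent_space top_of_set (points K)"
    unfolding homotopy_equivalent_space_def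
  proof (intro exI conjI)
    show "continuous_map (top_of_set (points ?C)) (top_of_set (points K)) to_faces"
      using to continuous_to_faces unfolding continuous_map_subtopology_eu image_subset_iff_funcset by blast
    show "continuous_map (top_of_set (points K)) (top_of_set (points ?C)) from_faces"
      using from' continuous_from_faces unfolding continuous_map_subtopology_eu image_subset_iff_funcset by blast
  qed (fact 1 2)+
  then show ?thesis
    using geometric_realization_finite[OF C] geometric_realization_finite[OF finite_K face_finite]
    by simp
qed

end

section \<open>Faces of the cube\<close>

text \<open>A clause is read as a partial assignment, the one that makes each of its literals false; the points
  of the cube that extend it form a face.\<close>

fun falsifying_value :: "'v literal \<Rightarrow> real" where
  "falsifying_value (Pos i) = 0"
| "falsifying_value (Neg i) = 1"

definition falsifying_face :: "'n clause \<Rightarrow> (real ^ 'n) set" where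
  "falsifying_face C = {x \<in> n_cube. \<forall>L\<in>C. x $ var L = falsifying_value L}"

lemma mem_n_cube: "x \<in> n_cube \<longleftrightarrow> (\<forall>i. 0 \<le> x $ i \<and> x $ i \<le> 1)"
  by (auto simp: n_cube_def mem_box_cart)

lemma finite_UNIV_literal: "finite (UNIV :: 'n::finite literal set)"
proof (rule finite_subset)
  show "UNIV \<subseteq> range Pos \<union> range (Neg :: 'n \<Rightarrow> _)"
  proof
    show "L \<in> range Pos \<union> range Neg" for L :: "'n literal"
      by (cases L) auto
  qed
qed simp

lemma convex_falsifying_face: "convex (falsifying_face C :: (real ^ 'n) set)"
proof -
  have "falsifying_face C = (n_cube :: (real ^ 'n) set) \<inter> (\<Inter>L\<in>C. {x. axis (var L) 1 \<bullet> x = falsifying_value L})"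
    by (auto simp: falsifying_face_def inner_axis')
  then show ?thesis
    by (simp add: n_cube_def convex_Int convex_INT convex_hyperplane)
qed

lemma convex_combination_eq_0:
  fixes a b u :: real
  assumes "0 < u" "u < 1" "0 \<le> a" "0 \<le> b" "(1 - u) * a + u * b = 0"
  shows "a = 0 \<and> b = 0"
proof -
  have "0 \<le> (1 - u) * a" "0 \<le> u * b"
    using assms by simp_all
  then have "(1 - u) * a = 0" "u * b = 0"
    using assms(5) by (metis add_nonneg_eq_0_iff)+
  then show ?thesis
    using assms(1,2) by auto
qed

text \<open>Both endpoints of the unit interval are extreme points; reflection reduces the endpoint 1 to the
  endpoint 0.\<close>

lemma convex_combination_eq_endpoint:
  fixes a b u c :: real
  assumes u: "0 < u" "u < 1" and ab: "0 \<le> a" "a \<le> 1" "0 \<le> b" "b \<le> 1"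
    and c: "c = 0 \<or> c = 1" and eq: "(1 - u) * a + u * b = c"
  shows "a = c \<and> b = c"
  using c
proof
  assume "c = 0"
  then show ?thesis
    using convex_combination_eq_0[OF u ab(1,3)] eq by simp
next
  assume "c = 1"
  have "(1 - u) * (1 - a) + u * (1 - b) = 1 - ((1 - u) * a + u * b)"
    by (simp add: algebra_simps)
  then have "(1 - u) * (1 - a) + u * (1 - b) = 0"
    unfolding eq \<open>c = 1\<close> by simp
  then have "1 - a = 0 \<and> 1 - b = 0"
    using ab by (intro convex_combination_eq_0[OF u]) simp_all
  then show ?thesis
    using \<open>c = 1\<close> by simp
qed

lemma falsifying_face_face_of: "falsifying_face C face_of (n_cube :: (real ^ 'n) set)"
  unfolding face_of_def
proof (intro conjI ballI impI convex_falsifying_face)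
  show "falsifying_face C \<subseteq> n_cube"
    by (auto simp: falsifying_face_def)
  fix a b x :: "real ^ 'n"
  assume ab: "a \<in> n_cube" "b \<in> n_cube" and x: "x \<in> falsifying_face C" "x \<in> open_segment a b"
  obtain u where u: "0 < u" "u < 1" "x = (1 - u) *\<^sub>R a + u *\<^sub>R b"
    using x(2) by (auto simp: in_segment)
  have "a $ var L = falsifying_value L \<and> b $ var L = falsifying_value L" if "L \<in> C" for L
  proof -
    have "(1 - u) * a $ var L + u * b $ var L = falsifying_value L"
      using x(1) that u(3) by (auto simp: falsifying_face_def)
    moreover have "falsifying_value L = 0 \<or> falsifying_value L = 1"
      by (cases L) auto
    ultimately show ?thesis
      using convex_combination_eq_endpoint[OF u(1,2), of "a $ var L" "b $ var L" "falsifying_value L"] ab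
      unfolding mem_n_cube by blast
  qed
  then show "a \<in> falsifying_face C" "b \<in> falsifying_face C"
    using ab by (auto simp: falsifying_face_def)
qed

text \<open>A relatively interior point \<open>z\<close> of a face \<open>F\<close> can have an integral coordinate only where that
  coordinate is constant on \<open>F\<close>. The constant coordinates make up a clause \<open>C\<close>. All other coordinates
  of \<open>z\<close> lie strictly between 0 and 1, so from any point of the face of \<open>C\<close> the segment to \<open>z\<close> can be
  prolonged beyond \<open>z\<close> inside the cube, and the point lies in \<open>F\<close> by the defining property of faces.\<close>

lemma face_eq_falsifying_face:
  fixes F :: "(real ^ 'n) set"
  assumes F: "F face_of n_cube" "F \<noteq> {}"
  obtains C where "inj_on var C" "F = falsifying_face C"
proof -
  define C where "C = {L. \<forall>x\<in>F. x $ var L = falsifying_value L}"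
  have FQ: "F \<subseteq> n_cube" "convex F"
    using F face_of_imp_subset face_of_imp_convex by auto
  obtain z where z: "z \<in> rel_interior F"
    using rel_interior_eq_empty[OF FQ(2)] F(2) by blast
  have zF: "z \<in> F"
    using z rel_interior_subset by blast
  have inj: "inj_on var C"
  proof (rule inj_onI)
    fix L M assume "L \<in> C" "M \<in> C" "var L = var M"
    then have "falsifying_value L = falsifying_value M"
      using zF by (auto simp: C_def)
    with \<open>var L = var M\<close> show "L = M"
      by (cases L; cases M) auto
  qed
  have sub: "F \<subseteq> falsifying_face C"
    using FQ(1) by (auto simp: falsifying_face_def C_def)
  \<comment> \<open>The points of \<open>F\<close> with the same value at \<open>var L\<close> as \<open>z\<close> form a face of \<open>F\<close>, which is all of \<open>F\<close>
      because it contains a relatively interior point.\<close>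
  have tight: "L \<in> C" if L: "z $ var L = falsifying_value L" for L
  proof -
    have "falsifying_face {L} \<inter> F face_of n_cube \<inter> F"
      by (rule face_of_Int_Int) (use falsifying_face_face_of F FQ in \<open>auto simp: face_of_refl\<close>)
    then have "falsifying_face {L} \<inter> F face_of F"
      using FQ(1) by (simp add: Int_absorb1)
    moreover have "z \<in> falsifying_face {L} \<inter> F"
      using L zF FQ(1) by (auto simp: falsifying_face_def)
    ultimately have "F \<subseteq> falsifying_face {L}"
      using subset_of_face_of[of _ F F] z by blast
    then show ?thesis
      by (auto simp: C_def falsifying_face_def)
  qed
  \<comment> \<open>A step from \<open>z\<close> of at most this size, in any coordinate that is not integral, stays in the cube. For an
      integral coordinate, where no step will be made, 1 is a placeholder.\<close>
  define \<epsilon> where "\<epsilon> = Min (range (\<lambda>i. if 0 < z $ i \<and> z $ i < 1 then min (z $ i) (1 - z $ i) else 1))"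
  have \<epsilon>: "0 < \<epsilon>" "\<And>i. 0 < z $ i \<Longrightarrow> z $ i < 1 \<Longrightarrow> \<epsilon> \<le> z $ i \<and> \<epsilon> \<le> 1 - z $ i"
  proof -
    show "0 < \<epsilon>"
      unfolding \<epsilon>_def by (subst Min_gr_iff) auto
    fix i assume "0 < z $ i" "z $ i < 1"
    moreover have "\<epsilon> \<le> (if 0 < z $ i \<and> z $ i < 1 then min (z $ i) (1 - z $ i) else 1)"
      unfolding \<epsilon>_def by (intro Min_le) auto
    ultimately show "\<epsilon> \<le> z $ i \<and> \<epsilon> \<le> 1 - z $ i"
      by auto
  qed
  have "x \<in> F" if x: "x \<in> falsifying_face C" "x \<noteq> z" for x
  proof -
    define w where "w = z + \<epsilon> *\<^sub>R (z - x)"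
    have xz: "x \<in> n_cube" "z \<in> n_cube"
      using x(1) zF FQ(1) by (auto simp: falsifying_face_def)
    have xC: "x $ var L = falsifying_value L" if "L \<in> C" for L
      using x(1) that by (simp add: falsifying_face_def)
    have "0 \<le> w $ i \<and> w $ i \<le> 1" for i
    proof (cases "0 < z $ i \<and> z $ i < 1")
      case True
      have "\<epsilon> * (z $ i - x $ i) \<le> \<epsilon> * 1" "\<epsilon> * (x $ i - z $ i) \<le> \<epsilon> * 1"
        using xz \<epsilon>(1) by (auto intro!: mult_left_mono simp: mem_n_cube diff_le_eq add_increasing2)
      then show ?thesis
        using \<epsilon>(2)[of i] True by (simp add: w_def algebra_simps)
    next
      case False
      then have "z $ i = 0 \<or> z $ i = 1"
        using xz(2) by (auto simp: mem_n_cube less_le)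
      then have "x $ i = z $ i"
        using tight[of "Pos i"] tight[of "Neg i"] xC[of "Pos i"] xC[of "Neg i"] by auto
      then show ?thesis
        using xz(2) by (simp add: w_def mem_n_cube)
    qed
    then have "w \<in> n_cube"
      by (simp add: mem_n_cube)
    moreover have "z \<in> open_segment x w"
      unfolding in_segment
    proof (intro conjI exI[of _ "1 / (1 + \<epsilon>)"])
      show "x \<noteq> w"
      proof
        assume "x = w"
        then have "(1 + \<epsilon>) *\<^sub>R (z - x) = 0"
          by (simp add: w_def algebra_simps)
        then show False
          using \<epsilon>(1) x(2) by simp
      qed
      have "(1 + \<epsilon>) *\<^sub>R z = \<epsilon> *\<^sub>R x + w"
        by (simp add: w_def algebra_simps)
      then have "z = (1 / (1 + \<epsilon>)) *\<^sub>R (\<epsilon> *\<^sub>R x + w)"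
        using \<epsilon>(1) by (metis add_pos_pos divide_self_if less_irrefl scaleR_one scaleR_scaleR times_divide_eq_left mult_1 zero_less_one)
      moreover have "1 - 1 / (1 + \<epsilon>) = 1 / (1 + \<epsilon>) * \<epsilon>"
        using \<epsilon>(1) by (simp add: field_simps)
      ultimately show "z = (1 - 1 / (1 + \<epsilon>)) *\<^sub>R x + (1 / (1 + \<epsilon>)) *\<^sub>R w"
        by (simp add: scaleR_add_right)
    qed (use \<epsilon>(1) in auto)
    ultimately show "x \<in> F"
      using face_ofD[OF F(1)] zF xz(1) by blast
  qed
  then have "falsifying_face C \<subseteq> F"
    using zF by blast
  with sub inj that show thesis
    by blast
qed

text \<open>Translate the midpoint \<open>c\<close> of the face to the origin. The translated face contains half of every
  coordinate vector whose index is not a variable of \<open>C\<close>, and has the same span as these vectors.\<close>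

lemma aff_dim_falsifying_face:
  assumes inj: "inj_on var C"
  shows "aff_dim (falsifying_face C :: (real ^ 'n) set) = int CARD('n) - int (card C)"
proof -
  define c :: "real ^ 'n" where
    "c = (\<chi> i. if Pos i \<in> C then 0 else if Neg i \<in> C then 1 else 1 / 2)"
  define D :: "(real ^ 'n) set" where "D = (\<lambda>i. axis i 1) ` (- var ` C)"
  let ?S = "(+) (- c) ` falsifying_face C"
  have cv: "c $ var L = falsifying_value L" if "L \<in> C" for L
    using that inj_onD[OF inj _ that, of "Pos (var L)"] by (cases L) (auto simp: c_def)
  have c_cube: "c \<in> n_cube"
    by (simp add: c_def mem_n_cube)
  have free: "c $ i = 1 / 2" if "i \<notin> var ` C" for i
    using that by (force simp: c_def)
  have "c \<in> falsifying_face C"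
    using cv c_cube by (simp add: falsifying_face_def)
  then have z: "0 \<in> ?S"
    by (force simp: image_iff)
  have V: "span D = {x. \<forall>i\<in>var ` C. x $ i = 0}"
  proof
    have "subspace {x :: real ^ 'n. \<forall>i\<in>var ` C. x $ i = 0}"
      by (auto simp: subspace_def)
    then show "span D \<subseteq> {x. \<forall>i\<in>var ` C. x $ i = 0}"
      by (intro span_minimal) (auto simp: D_def axis_def)
    show "{x. \<forall>i\<in>var ` C. x $ i = 0} \<subseteq> span D"
    proof
      fix x :: "real ^ 'n"
      assume x: "x \<in> {x. \<forall>i\<in>var ` C. x $ i = 0}"
      have "x $ i *\<^sub>R axis i 1 \<in> span D" for i
      proof (cases "i \<in> var ` C")
        case True
        with x have "x $ i = 0"
          by blast
        then show ?thesis
          by (simp add: span_zero)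
      next
        case False
        then show ?thesis
          by (intro span_scale span_base) (auto simp: D_def)
      qed
      then have "(\<Sum>i\<in>UNIV. x $ i *\<^sub>R axis i 1) \<in> span D"
        by (intro span_sum)
      then show "x \<in> span D"
        using basis_expansion[of x] by (simp add: scalar_mult_eq_scaleR)
    qed
  qed
  have "?S \<subseteq> span D"
    using cv unfolding V by (auto simp: falsifying_face_def)
  moreover have "D \<subseteq> span ?S"
  proof
    fix d assume "d \<in> D"
    then obtain i where i: "d = axis i 1" "i \<notin> var ` C"
      by (auto simp: D_def)
    have "c + (1 / 2) *\<^sub>R d \<in> falsifying_face C"
      using cv c_cube free[OF i(2)] i by (force simp: falsifying_face_def mem_n_cube axis_def)
    then have "(1 / 2) *\<^sub>R d \<in> ?S"
      by (force simp: image_iff)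
    then have "2 *\<^sub>R ((1 / 2) *\<^sub>R d) \<in> span ?S"
      by (intro span_scale span_base)
    then show "d \<in> span ?S"
      by simp
  qed
  ultimately have "span ?S = span D"
    by (metis span_minimal subspace_span subset_antisym)
  then have "dim ?S = dim D"
    by (metis dim_span)
  also have "dim D = card D"
    by (rule dim_eq_card_independent, rule independent_mono[OF independent_Basis])
       (auto simp: D_def axis_in_Basis_iff)
  also have "card D = card (- var ` C)"
    unfolding D_def by (rule card_image) (auto simp: inj_on_def axis_eq_axis)
  also have "\<dots> = CARD('n) - card C"
    using card_image[OF inj] by (simp add: Compl_eq_Diff_UNIV card_Diff_subset)
  finally have "dim ?S = CARD('n) - card C" .
  moreover have "card C \<le> CARD('n)"
    using card_image[OF inj] by (metis card_mono finite subset_UNIV)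
  moreover have "aff_dim (falsifying_face C) = int (dim ?S)"
    using aff_dim_zero[OF hull_inc[OF z]] aff_dim_translation_eq[of "- c" "falsifying_face C"] by metis
  ultimately show ?thesis
    by simp
qed

text \<open>The extreme points are the zero-dimensional faces, which belong to the clauses in which every
  variable occurs.\<close>

lemma cube_vertices_eq: "cube_vertices = {v :: real ^ 'n. \<forall>i. v $ i = 0 \<or> v $ i = 1}"
proof (intro equalityI subsetI CollectI)
  fix v :: "real ^ 'n"
  assume "v \<in> cube_vertices"
  then have "{v} face_of n_cube"
    by (simp add: cube_vertices_def face_of_singleton)
  then obtain C where C: "inj_on var C" "{v} = falsifying_face C"
    by (rule face_eq_falsifying_face) auto
  have "card (var ` C) = CARD('n)"
    using aff_dim_falsifying_face[OF C(1)] C(2) card_image[OF C(1)]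
    by (metis aff_dim_sing diff_eq_diff_eq of_nat_eq_iff right_minus_eq)
  then have "var ` C = UNIV"
    by (intro card_subset_eq) auto
  then have "\<exists>L\<in>C. i = var L" for i
    by auto
  moreover have "v $ var L = falsifying_value L" if "L \<in> C" for L
    using C(2) that by (auto simp: falsifying_face_def)
  moreover have "falsifying_value L = 0 \<or> falsifying_value L = 1" for L :: "'n literal"
    by (cases L) auto
  ultimately show "\<forall>i. v $ i = 0 \<or> v $ i = 1"
    by metis
next
  fix v :: "real ^ 'n"
  assume "v \<in> {v. \<forall>i. v $ i = 0 \<or> v $ i = 1}"
  then have v: "v $ i = 0 \<or> v $ i = 1" for i
    by simp
  define C where "C = range (\<lambda>i. if v $ i = 0 then Pos i else Neg i)"
  have "falsifying_face C = {v}"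
  proof (intro equalityI subsetI)
    fix x assume "x \<in> falsifying_face C"
    then have "x $ var L = falsifying_value L" if "L \<in> C" for L
      using that by (simp add: falsifying_face_def)
    then have "x $ i = v $ i" for i
      using v[of i] rangeI[of "\<lambda>i. if v $ i = 0 then Pos i else Neg i" i] unfolding C_def
      by (metis falsifying_value.simps literal.sel)
    then show "x \<in> {v}"
      by (simp add: vec_eq_iff)
  next
    fix x assume "x \<in> {v}"
    moreover have "v \<in> n_cube"
      unfolding mem_n_cube using v by (metis order_refl zero_le_one)
    moreover have "v $ var L = falsifying_value L" if "L \<in> C" for L
      using that v unfolding C_def by fastforce
    ultimately show "x \<in> falsifying_face C"
      by (simp add: falsifying_face_def)
  qed
  then show "v \<in> cube_vertices"
    using falsifying_face_face_of[of C] by (simp add: cube_vertices_def face_of_singleton)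
qed

lemma finite_cube_vertices: "finite (cube_vertices :: (real ^ 'n) set)"
proof -
  have "cube_vertices \<subseteq> range (\<lambda>A. \<chi> i. if i \<in> A then 1 else 0 :: real ^ 'n)"
  proof
    fix v :: "real ^ 'n"
    assume "v \<in> cube_vertices"
    then have "v = (\<chi> i. if i \<in> {i. v $ i = 1} then 1 else 0)"
      by (auto simp: vec_eq_iff cube_vertices_eq)
    then show "v \<in> range (\<lambda>A. \<chi> i. if i \<in> A then 1 else 0)"
      by blast
  qed
  then show ?thesis
    by (rule finite_subset) simp
qed

section \<open>Satisfying vertices\<close>

definition assignment :: "real ^ 'n \<Rightarrow> 'n \<Rightarrow> bool" where
  "assignment v i \<longleftrightarrow> v $ i = 1"

lemma literal_true_assignment:
  assumes "v \<in> cube_vertices"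
  shows "literal_true (assignment v) L \<longleftrightarrow> v $ var L \<noteq> falsifying_value L"
proof -
  have "v $ var L = 0 \<or> v $ var L = 1"
    using assms by (simp add: cube_vertices_eq)
  then show ?thesis
    by (cases L) (auto simp: assignment_def)
qed

lemma assignment_surj:
  obtains v :: "real ^ 'n" where "v \<in> cube_vertices" "assignment v = a"
proof
  show "(\<chi> i. if a i then 1 else 0) \<in> (cube_vertices :: (real ^ 'n) set)"
    by (simp add: cube_vertices_eq)
  show "assignment (\<chi> i. if a i then 1 else 0) = a"
    by (rule ext) (simp add: assignment_def)
qed

definition satisfying_vertices :: "'n cnf \<Rightarrow> (real ^ 'n) set" where
  "satisfying_vertices \<phi> = {v \<in> cube_vertices. models (assignment v) \<phi>}"

lemma finite_satisfying_vertices: "finite (satisfying_vertices \<phi>)"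
  by (rule finite_subset[OF _ finite_cube_vertices]) (auto simp: satisfying_vertices_def)

lemma logically_implies_iff:
  "logically_implies \<phi> \<psi> \<longleftrightarrow> satisfying_vertices \<phi> \<subseteq> satisfying_vertices \<psi>"
proof
  assume "satisfying_vertices \<phi> \<subseteq> satisfying_vertices \<psi>"
  then show "logically_implies \<phi> \<psi>"
    unfolding logically_implies_def
    by (metis (mono_tags, lifting) assignment_surj mem_Collect_eq satisfying_vertices_def subsetD)
qed (auto simp: logically_implies_def satisfying_vertices_def)

lemma cube_vertices_falsifying_face:
  "cube_vertices \<inter> falsifying_face C = {v \<in> cube_vertices. \<not> models (assignment v) {C}}"
proof -
  have "v \<in> n_cube" if "v \<in> cube_vertices" for v :: "real ^ 'n"
    using that by (auto simp: cube_vertices_def extreme_point_of_def)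
  then show ?thesis
    by (auto simp: falsifying_face_def models_def literal_true_assignment)
qed

lemma Theta_Cube_eq:
  assumes "l \<le> CARD('n)"
  shows "Theta (Cube (CARD('n) - l) :: (real ^ 'n) hypergraph) =
    {\<sigma>. \<sigma> \<noteq> {} \<and> (\<exists>C. is_clause l C \<and> \<sigma> \<subseteq> satisfying_vertices {C})}"
proof -
  let ?k = "CARD('n) - l"
  have "{F :: (real ^ 'n) set. F face_of n_cube \<and> aff_dim F = int ?k} = falsifying_face ` {C. is_clause l C}"
  proof (intro equalityI subsetI)
    fix F :: "(real ^ 'n) set"
    assume "F \<in> {F. F face_of n_cube \<and> aff_dim F = int ?k}"
    then have F: "F face_of n_cube" "aff_dim F = int ?k"
      by auto
    then have "F \<noteq> {}"
      by auto
    then obtain C where C: "inj_on var C" "F = falsifying_face C"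
      using face_eq_falsifying_face[OF F(1)] by blast
    have "card C = l"
      using aff_dim_falsifying_face[OF C(1)] F(2) C(2) assms by (simp add: of_nat_diff)
    moreover have "finite C"
      by (rule finite_subset[OF subset_UNIV finite_UNIV_literal])
    ultimately show "F \<in> falsifying_face ` {C. is_clause l C}"
      using C by (auto simp: is_clause_def)
  next
    fix F :: "(real ^ 'n) set"
    assume "F \<in> falsifying_face ` {C. is_clause l C}"
    then show "F \<in> {F. F face_of n_cube \<and> aff_dim F = int ?k}"
      using assms by (auto simp: is_clause_def falsifying_face_face_of aff_dim_falsifying_face of_nat_diff)
  qed
  moreover have "snd (Cube ?k :: (real ^ 'n) hypergraph) =
      (\<inter>) cube_vertices ` {F. F face_of n_cube \<and> aff_dim F = int ?k}"
    unfolding Cube_hyperedges by (rule setcompr_eq_image)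
  ultimately have "snd (Cube ?k :: (real ^ 'n) hypergraph) =
      (\<lambda>C. cube_vertices \<inter> falsifying_face C) ` {C. is_clause l C}"
    by (simp only: image_image)
  then have "Theta (Cube ?k :: (real ^ 'n) hypergraph) =
      {\<sigma>. \<sigma> \<noteq> {} \<and> finite \<sigma> \<and> (\<exists>C. is_clause l C \<and> \<sigma> \<subseteq> cube_vertices - cube_vertices \<inter> falsifying_face C)}"
    by (simp add: Theta_def) (simp add: Cube_def)
  moreover have "cube_vertices - cube_vertices \<inter> falsifying_face C = satisfying_vertices {C}" for C :: "'n clause"
    unfolding cube_vertices_falsifying_face by (auto simp: satisfying_vertices_def)
  moreover have "finite \<sigma>" if "\<sigma> \<subseteq> satisfying_vertices {C}" for \<sigma> and C :: "'n clause"
    using that by (rule finite_subset[OF _ finite_satisfying_vertices])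
  ultimately show ?thesis
    by (simp only:) (intro Collect_cong, metis)
qed

text \<open>To list a finite chain of formulas in an order of successive implications, sort it by the number of
  satisfying vertices: implication cannot decrease it, so for comparable formulas the order of these
  numbers decides which one implies the other.\<close>

lemma SAT_complex_eq: "SAT_complex l = chain_complex (SAT l) (satisfying_vertices :: 'n::finite cnf \<Rightarrow> _)"
proof (intro equalityI subsetI)
  fix S :: "'n cnf set"
  assume "S \<in> SAT_complex l"
  then obtain \<phi>s where s: "S = set \<phi>s" "\<phi>s \<noteq> []" "set \<phi>s \<subseteq> SAT l"
    and "successively logically_implies \<phi>s"
    by (auto simp: SAT_complex_def)
  then have "sorted_wrt logically_implies \<phi>s"
    using successively_conv_sorted_wrt[of logically_implies]
    by (auto simp: transp_def logically_implies_def)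
  then have "logically_implies \<phi> \<psi> \<or> logically_implies \<psi> \<phi>" if "\<phi> \<in> set \<phi>s" "\<psi> \<in> set \<phi>s" for \<phi> \<psi>
    using that by (induction \<phi>s) (auto simp: logically_implies_def)
  with s show "S \<in> chain_complex (SAT l) satisfying_vertices"
    by (auto simp: chain_complex_def logically_implies_iff)
next
  fix S :: "'n cnf set"
  assume S: "S \<in> chain_complex (SAT l) satisfying_vertices"
  let ?size = "\<lambda>\<phi>::'n cnf. card (satisfying_vertices \<phi>)"
  obtain xs where xs: "set xs = S" "distinct xs"
    using S finite_distinct_list[of S] unfolding chain_complex_def by blast
  define \<phi>s where "\<phi>s = sort_key ?size xs"
  have set: "set \<phi>s = S" "distinct \<phi>s"
    using xs by (simp_all add: \<phi>s_def)
  have imp: "logically_implies \<phi> \<psi>" if "\<phi> \<in> S" "\<psi> \<in> S" "?size \<phi> \<le> ?size \<psi>" for \<phi> \<psi>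
  proof (rule ccontr)
    assume "\<not> logically_implies \<phi> \<psi>"
    then have "satisfying_vertices \<psi> \<subset> satisfying_vertices \<phi>"
      using S that(1,2) by (auto simp: chain_complex_def logically_implies_iff)
    then have "?size \<psi> < ?size \<phi>"
      by (rule psubset_card_mono[OF finite_satisfying_vertices])
    with that(3) show False
      by simp
  qed
  have "sorted_wrt (\<lambda>\<phi> \<psi>. ?size \<phi> \<le> ?size \<psi>) \<phi>s"
    using sorted_sort_key[of ?size xs] by (simp add: \<phi>s_def sorted_map)
  then have "sorted_wrt logically_implies \<phi>s"
    by (rule sorted_wrt_mono_rel[rotated]) (use set imp in auto)
  then have "successively logically_implies \<phi>s"
    using successively_if_sorted_wrt by blast
  then show "S \<in> SAT_complex l"
    using set S by (force simp: SAT_complex_def chain_complex_def)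
qed

definition all_satisfied_clauses :: "nat \<Rightarrow> (real ^ 'n) set \<Rightarrow> 'n cnf" where
  "all_satisfied_clauses l \<sigma> = {C. is_clause l C \<and> \<sigma> \<subseteq> satisfying_vertices {C}}"

lemma subset_satisfying_vertices_iff:
  "\<sigma> \<subseteq> satisfying_vertices \<phi> \<longleftrightarrow> \<sigma> \<subseteq> cube_vertices \<and> (\<forall>C\<in>\<phi>. \<sigma> \<subseteq> satisfying_vertices {C})"
  by (auto simp: satisfying_vertices_def models_def)

text \<open>A formula holds on all of \<open>\<sigma>\<close> iff each of its clauses does, that is, iff it is a subset of the
  conjunction of all clauses that hold on \<open>\<sigma>\<close>. This conjunction is nonempty because \<open>\<sigma>\<close> is a
  simplex, and satisfiable because \<open>\<sigma>\<close> is nonempty.\<close>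

lemma face_galois_SAT:
  assumes "l \<le> CARD('n)"
  shows "face_galois (Theta (Cube (CARD('n) - l) :: (real ^ 'n) hypergraph)) (SAT l)
    satisfying_vertices (all_satisfied_clauses l)"
proof
  let ?K = "Theta (Cube (CARD('n) - l)) :: (real ^ 'n) set set"
  note K = Theta_Cube_eq[OF assms]
  show "abstract_complex ?K"
    by (rule abstract_complex_Theta)
  have "\<Union>?K \<subseteq> cube_vertices"
    by (auto simp: K satisfying_vertices_def)
  then show "finite (\<Union>?K)"
    using finite_cube_vertices finite_subset by blast
  have finite_cnf: "finite (UNIV :: 'n cnf set)" "finite (UNIV :: 'n clause set)"
    using finite_UNIV_literal by (simp_all add: Finite_Set.finite_set)
  then show "finite (SAT l :: 'n cnf set)"
    by (metis finite_subset subset_UNIV)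
  show "satisfying_vertices \<phi> \<in> ?K" if "\<phi> \<in> SAT l" for \<phi>
  proof -
    obtain C where C: "C \<in> \<phi>" "is_clause l C"
      using \<open>\<phi> \<in> SAT l\<close> by (auto simp: SAT_def is_cnf_def)
    obtain a where "models a \<phi>"
      using \<open>\<phi> \<in> SAT l\<close> by (auto simp: SAT_def)
    then have "satisfying_vertices \<phi> \<noteq> {}"
      using assignment_surj[of a] by (auto simp: satisfying_vertices_def)
    moreover have "satisfying_vertices \<phi> \<subseteq> satisfying_vertices {C}"
      using C(1) by (auto simp: satisfying_vertices_def models_def)
    ultimately show ?thesis
      using C(2) by (auto simp: K)
  qed
  fix \<sigma> assume \<sigma>: "\<sigma> \<in> ?K"
  then obtain v where v: "v \<in> \<sigma>"
    by (auto simp: K)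
  have \<sigma>V: "\<sigma> \<subseteq> cube_vertices"
    using \<sigma> by (auto simp: K satisfying_vertices_def)
  have cl: "\<sigma> \<subseteq> satisfying_vertices (all_satisfied_clauses l \<sigma>)"
    by (subst subset_satisfying_vertices_iff) (auto simp: \<sigma>V all_satisfied_clauses_def)
  then have "models (assignment v) (all_satisfied_clauses l \<sigma>)"
    using v by (auto simp: satisfying_vertices_def)
  moreover have "finite (all_satisfied_clauses l \<sigma>)"
    by (metis finite_cnf(2) finite_subset subset_UNIV)
  moreover have "all_satisfied_clauses l \<sigma> \<noteq> {}" "\<forall>C\<in>all_satisfied_clauses l \<sigma>. is_clause l C"
    using \<sigma> by (auto simp: K all_satisfied_clauses_def)
  ultimately show "all_satisfied_clauses l \<sigma> \<in> SAT l"
    by (auto simp: SAT_def is_cnf_def)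
  fix \<phi> :: "'n cnf" assume \<phi>: "\<phi> \<in> SAT l"
  show "satisfying_vertices (all_satisfied_clauses l \<sigma>) \<subseteq> satisfying_vertices \<phi> \<longleftrightarrow> \<sigma> \<subseteq> satisfying_vertices \<phi>"
  proof
    assume "\<sigma> \<subseteq> satisfying_vertices \<phi>"
    then have "\<phi> \<subseteq> all_satisfied_clauses l \<sigma>"
      using \<phi> subset_satisfying_vertices_iff[of \<sigma> \<phi>]
      by (auto simp: SAT_def is_cnf_def all_satisfied_clauses_def)
    then show "satisfying_vertices (all_satisfied_clauses l \<sigma>) \<subseteq> satisfying_vertices \<phi>"
      by (auto simp: satisfying_vertices_def models_def)
  qed (use cl in blast)
qed

theorem theorem3:
  fixes n l :: nat
  assumes "CARD('n::finite) = n" and "n \<ge> 1" and "1 \<le> l" and "l \<le> n"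
  shows "geometric_realization (SAT_complex l :: 'n cnf set set) homotopy_equivalent_space
         geometric_realization (Theta (Cube (n - l) :: (real ^ 'n) hypergraph))"
proof -
  interpret face_galois "Theta (Cube (CARD('n) - l) :: (real ^ 'n) hypergraph)" "SAT l"
    satisfying_vertices "all_satisfied_clauses l"
    using assms by (intro face_galois_SAT) simp
  show ?thesis
    using homotopy_equivalent_chain_complex assms(1) by (simp add: SAT_complex_eq)
qed

end
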